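(* Let $f:(X,\kappa)\to(Y,\lambda)$ be a digital isomorphism between digital images. Then $f$ is universal for $(X,Y)$ if and only if $(X,\kappa)$ has the approximate fixed point property (AFPP).
   Context: A digital image is a pair $(X,\kappa)$ where $\emptyset\neq X\subset\mathbf{Z}^n$ for some positive integer $n$ and $\kappa$ is an adjacency relation on $X$ (a symmetric, irreflexive relation, so that $(X,\kappa)$ is an undirected simple graph with vertex set $X$). Write $a\leftrightarrow_\kappa b$ if $a=b$ or $a,b$ are $\kappa$-adjacent. A subset $A\subset X$ is $\kappa$-connected if for every two distinct points $x,y\in A$ there are $x=x_0,\ldots,x_c=y$ in $A$ with consecutive points $\kappa$-adjacent. A function $f:(X,\kappa)\to(Y,\lambda)$ between digital images is $(\kappa,\lambda)$-continuous if $f(A)$ is $\lambda$-connected for every $\kappa$-connected $A\subset X$; equivalently, whenever $x_0,x_1\in X$ are $\kappa$-adjacent, $f(x_0)\leftrightarrow_\lambda f(x_1)$. A digital isomorphism (or $(\kappa,\lambda)$-isomorphism) is a $(\kappa,\lambda)$-continuous bijection $h:X\to Y$ whose inverse is $(\lambda,\kappa)$-continuous. The digital image $(X,\kappa)$ has the approximate fixed point property (AFPP) if every $(\kappa,\kappa)$-continuous $f:X\to X$ has a point $p\in X$ with $f(p)\leftrightarrow_\kappa p$. A $(\kappa,\lambda)$-continuous function $f:X\to Y$ is universal for $(X,Y)$ if for every $(\kappa,\lambda)$-continuous function $g:X\to Y$ there exists $x\in X$ such that $f(x)\leftrightarrow_\lambda g(x)$. *)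

theory Defs
  imports "HOL-Analysis.Finite_Cartesian_Product"
begin

text \<open>
  The lattice \<open>Z^n\<close> is the type \<open>int ^ 'n\<close>, where \<open>'n\<close> is a (nonempty) finite index type.
  An adjacency relation on \<open>X\<close> is a set of pairs of points of \<open>X\<close>. A function from \<open>X\<close> to \<open>Y\<close>
  is a total function mapping \<open>X\<close> into \<open>Y\<close>; its values outside \<open>X\<close> play no role in any of the
  notions below.
\<close>

definition digital_image :: "(int ^ 'n) set \<Rightarrow> (int ^ 'n) rel \<Rightarrow> bool" where
  "digital_image X \<kappa> \<longleftrightarrow> X \<noteq> {} \<and> \<kappa> \<subseteq> X \<times> X \<and> sym \<kappa> \<and> irrefl \<kappa>"

definition adj_or_eq :: "'a rel \<Rightarrow> 'a \<Rightarrow> 'a \<Rightarrow> bool" where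
  "adj_or_eq \<kappa> a b \<longleftrightarrow> a = b \<or> (a, b) \<in> \<kappa>"

definition digitally_connected :: "'a rel \<Rightarrow> 'a set \<Rightarrow> bool" where
  "digitally_connected \<kappa> A \<longleftrightarrow>
     (\<forall>x\<in>A. \<forall>y\<in>A. x \<noteq> y \<longrightarrow>
        (\<exists>(p :: nat \<Rightarrow> 'a) c. p 0 = x \<and> p c = y \<and> (\<forall>i\<le>c. p i \<in> A) \<and>
           (\<forall>i<c. (p i, p (Suc i)) \<in> \<kappa>)))"

definition digitally_continuous ::
  "'a set \<Rightarrow> 'a rel \<Rightarrow> 'b set \<Rightarrow> 'b rel \<Rightarrow> ('a \<Rightarrow> 'b) \<Rightarrow> bool" where
  "digitally_continuous X \<kappa> Y \<mu> f \<longleftrightarrow>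
     f ` X \<subseteq> Y \<and>
     (\<forall>A\<subseteq>X. digitally_connected \<kappa> A \<longrightarrow> digitally_connected \<mu> (f ` A))"

definition digital_isomorphism ::
  "'a set \<Rightarrow> 'a rel \<Rightarrow> 'b set \<Rightarrow> 'b rel \<Rightarrow> ('a \<Rightarrow> 'b) \<Rightarrow> bool" where
  "digital_isomorphism X \<kappa> Y \<mu> h \<longleftrightarrow>
     digitally_continuous X \<kappa> Y \<mu> h \<and> bij_betw h X Y \<and>
     digitally_continuous Y \<mu> X \<kappa> (inv_into X h)"

definition AFPP :: "'a set \<Rightarrow> 'a rel \<Rightarrow> bool" where
  "AFPP X \<kappa> \<longleftrightarrow>
     (\<forall>f. digitally_continuous X \<kappa> X \<kappa> f \<longrightarrow> (\<exists>p\<in>X. adj_or_eq \<kappa> (f p) p))"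

definition universal_map ::
  "'a set \<Rightarrow> 'a rel \<Rightarrow> 'b set \<Rightarrow> 'b rel \<Rightarrow> ('a \<Rightarrow> 'b) \<Rightarrow> bool" where
  "universal_map X \<kappa> Y \<mu> f \<longleftrightarrow>
     digitally_continuous X \<kappa> Y \<mu> f \<and>
     (\<forall>g. digitally_continuous X \<kappa> Y \<mu> g \<longrightarrow> (\<exists>x\<in>X. adj_or_eq \<mu> (f x) (g x)))"

end

theory Submission
  imports Defs
begin

text \<open>Composition with the isomorphism \<open>f\<close> turns continuous self-maps of
  \<open>X\<close> into continuous maps from \<open>X\<close> to \<open>Y\<close>, and composition
  with its inverse reverses this. Both \<open>f\<close> and its inverse preserve the relation "equal
  or adjacent", so a self-map \<open>g\<close> moves \<open>x\<close> to an equal or adjacent point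
  exactly when \<open>f x\<close> and \<open>f (g x)\<close> are equal or adjacent. Universality of
  \<open>f\<close>, tested on such composites, is therefore the AFPP. The two ingredients are
  \<open>digitally_continuous_comp\<close> and \<open>digitally_continuous_adj_or_eq\<close>; the
  latter recovers the pointwise form of continuity from its definition by connected sets.\<close>

lemma adj_or_eq_sym:
  assumes "sym \<kappa>" "adj_or_eq \<kappa> a b"
  shows "adj_or_eq \<kappa> b a"
  using assms by (auto simp: adj_or_eq_def dest: symD)

lemma digitally_continuous_comp:
  assumes "digitally_continuous X \<kappa> Y \<mu> f" "digitally_continuous Y \<mu> Z \<nu> g"
  shows "digitally_continuous X \<kappa> Z \<nu> (g \<circ> f)"
  unfolding digitally_continuous_def
proof (intro conjI allI impI)
  show "(g \<circ> f) ` X \<subseteq> Z"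
    using assms by (fastforce simp: digitally_continuous_def)
next
  fix A assume "A \<subseteq> X" "digitally_connected \<kappa> A"
  then have "f ` A \<subseteq> Y" "digitally_connected \<mu> (f ` A)"
    using assms(1) by (auto simp: digitally_continuous_def)
  then show "digitally_connected \<nu> ((g \<circ> f) ` A)"
    using assms(2) unfolding digitally_continuous_def image_comp [symmetric] by simp
qed

text \<open>This is the bridge between connectedness of sets and adjacency of points: a path inside
  a two-point set that joins its points must at some moment step directly from one to the
  other.\<close>

lemma digitally_connected_pair_iff:
  assumes "sym \<kappa>"
  shows "digitally_connected \<kappa> {a, b} \<longleftrightarrow> adj_or_eq \<kappa> a b"
proof
  assume conn: "digitally_connected \<kappa> {a, b}"
  show "adj_or_eq \<kappa> a b"
  proof (rule ccontr)
    assume contr: "\<not> adj_or_eq \<kappa> a b"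
    then have "a \<noteq> b"
      by (simp add: adj_or_eq_def)
    with conn obtain p :: "nat \<Rightarrow> 'a" and c where p: "p 0 = a" "p c = b"
        "\<forall>i\<le>c. p i \<in> {a, b}" "\<forall>i<c. (p i, p (Suc i)) \<in> \<kappa>"
      unfolding digitally_connected_def by (metis insertI1 insertI2)
    \<comment> \<open>With no edge from \<open>a\<close> to \<open>b\<close>, a path confined to
      \<open>{a, b}\<close> that starts at \<open>a\<close> never leaves \<open>a\<close>, so it
      cannot end at \<open>b\<close>.\<close>
    have "i \<le> c \<Longrightarrow> p i = a" for i
    proof (induction i)
      case (Suc i)
      then have "p i = a" "i < c"
        by simp_all
      then have "(a, p (Suc i)) \<in> \<kappa>"
        using p(4) by metis
      moreover have "p (Suc i) \<in> {a, b}"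
        using p(3) Suc.prems by blast
      ultimately show ?case
        using contr by (auto simp: adj_or_eq_def)
    qed (simp add: p)
    then show False
      using contr p(2) by (auto simp: adj_or_eq_def)
  qed
next
  assume adj: "adj_or_eq \<kappa> a b"
  show "digitally_connected \<kappa> {a, b}"
    unfolding digitally_connected_def
  proof (intro ballI impI)
    fix x y assume "x \<in> {a, b}" "y \<in> {a, b}" "x \<noteq> y"
    moreover from this have "(x, y) \<in> \<kappa>"
      using adj assms by (auto simp: adj_or_eq_def dest: symD)
    ultimately show "\<exists>(p :: nat \<Rightarrow> 'a) c. p 0 = x \<and> p c = y \<and>
        (\<forall>i\<le>c. p i \<in> {a, b}) \<and> (\<forall>i<c. (p i, p (Suc i)) \<in> \<kappa>)"
      \<comment> \<open>A single edge is a path of length 1.\<close>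
      by (intro exI[of _ "\<lambda>i. if i = 0 then x else y"] exI[of _ 1]) simp
  qed
qed

text \<open>Continuity is tested on the connected set \<open>{a, b}\<close>, whose image is again a
  set of at most two points.\<close>

lemma digitally_continuous_adj_or_eq:
  assumes "digitally_continuous X \<kappa> Y \<mu> f" "sym \<kappa>" "sym \<mu>"
    and "a \<in> X" "b \<in> X" "adj_or_eq \<kappa> a b"
  shows "adj_or_eq \<mu> (f a) (f b)"
proof -
  have "digitally_connected \<mu> (f ` {a, b})"
    using assms(1,4-6) digitally_connected_pair_iff[OF assms(2), of a b]
    by (simp add: digitally_continuous_def del: image_insert)
  then show ?thesis
    using digitally_connected_pair_iff[OF assms(3), of "f a" "f b"] by simp
qed

theorem corollary6p9:
  fixes X :: "(int ^ 'n) set" and \<kappa> :: "(int ^ 'n) rel"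
    and Y :: "(int ^ 'm) set" and \<mu> :: "(int ^ 'm) rel"
    and f :: "int ^ 'n \<Rightarrow> int ^ 'm"
  assumes "digital_image X \<kappa>"
    and "digital_image Y \<mu>"
    and "digital_isomorphism X \<kappa> Y \<mu> f"
  shows "universal_map X \<kappa> Y \<mu> f \<longleftrightarrow> AFPP X \<kappa>"
proof -
  let ?h = "inv_into X f"
  have sym: "sym \<kappa>" "sym \<mu>"
    using assms(1,2) by (auto simp: digital_image_def)
  have f: "digitally_continuous X \<kappa> Y \<mu> f" and h: "digitally_continuous Y \<mu> X \<kappa> ?h"
    and bij: "bij_betw f X Y"
    using assms(3) by (auto simp: digital_isomorphism_def)
  have fX: "f x \<in> Y" and hf: "?h (f x) = x" if "x \<in> X" for x
    by (rule bij_betw_apply[OF bij that], rule bij_betw_inv_into_left[OF bij that])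
  have hY: "?h y \<in> X" and fh: "f (?h y) = y" if "y \<in> Y" for y
    by (rule bij_betw_apply[OF bij_betw_inv_into[OF bij] that],
      rule bij_betw_inv_into_right[OF bij that])
  show ?thesis
  proof
    assume univ: "universal_map X \<kappa> Y \<mu> f"
    show "AFPP X \<kappa>"
      unfolding AFPP_def
    proof (intro allI impI)
      fix g assume g: "digitally_continuous X \<kappa> X \<kappa> g"
      \<comment> \<open>Universality is applied to the composite \<open>f \<circ> g\<close>.\<close>
      then obtain x where x: "x \<in> X" "adj_or_eq \<mu> (f x) (f (g x))"
        using univ digitally_continuous_comp[OF g f] by (auto simp: universal_map_def)
      have gx: "g x \<in> X"
        using g x(1) by (auto simp: digitally_continuous_def)
      \<comment> \<open>The continuous inverse \<open>?h\<close> carries the relation from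
        \<open>Y\<close> back to \<open>X\<close>, and \<open>hf\<close> cancels it against
        \<open>f\<close>.\<close>
      have "adj_or_eq \<kappa> x (g x)"
        using digitally_continuous_adj_or_eq[OF h sym(2,1) fX fX x(2)] x(1) gx
        by (simp add: hf)
      then show "\<exists>p\<in>X. adj_or_eq \<kappa> (g p) p"
        by (rule bexI[OF adj_or_eq_sym[OF sym(1)] x(1)])
    qed
  next
    assume afpp: "AFPP X \<kappa>"
    show "universal_map X \<kappa> Y \<mu> f"
      unfolding universal_map_def
    proof (intro conjI allI impI f)
      fix g assume g: "digitally_continuous X \<kappa> Y \<mu> g"
      \<comment> \<open>Pulling \<open>g\<close> back along the inverse gives the self-map
        \<open>?h \<circ> g\<close> of \<open>X\<close>, to which the AFPP applies.\<close>
      then obtain p where p: "p \<in> X" "adj_or_eq \<kappa> (?h (g p)) p"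
        using afpp digitally_continuous_comp[OF g h] by (auto simp: AFPP_def)
      have gp: "g p \<in> Y"
        using g p(1) by (auto simp: digitally_continuous_def)
      \<comment> \<open>Pushing forward by \<open>f\<close> turns \<open>?h (g p)\<close> into
        \<open>g p\<close>, by \<open>fh\<close>.\<close>
      have "adj_or_eq \<mu> (g p) (f p)"
        using digitally_continuous_adj_or_eq[OF f sym hY p(1) p(2)] gp by (simp add: fh)
      then show "\<exists>x\<in>X. adj_or_eq \<mu> (f x) (g x)"
        by (rule bexI[OF adj_or_eq_sym[OF sym(2)] p(1)])
    qed
  qed
qed

end
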